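(* Every uniform semigroup $S$ with $|S|\ge 2$ is an $E$-semigroup; that is, the product of any two idempotents of $S$ is an idempotent.
   Context: A right $S$-act is a nonempty set $A$ with a map $A\times S\to A$, $(a,s)\mapsto as$, with $a(st)=(as)t$. A subact is a nonempty subset closed under the action; an $S$-homomorphism is a map $f$ with $f(as)=f(a)s$; a monomorphism is an injective $S$-homomorphism. A subact is nonzero if it is not a one-element subact. A subact $B$ of $A$ is large in $A$ if every $S$-homomorphism $g:A\to C$ (for any right $S$-act $C$) whose restriction to $B$ is injective is itself injective. A right $S$-act is uniform if every nonzero subact is large in it. A semigroup $S$ is uniform (i.e. right uniform) if the right $S$-act $S_S$ ($S$ acting on itself by right multiplication; its subacts are the nonempty right ideals) is uniform. A semigroup is an $E$-semigroup if its set of idempotents $E(S)$ is a subsemigroup, i.e. closed under multiplication (vacuously so if $E(S)=\emptyset$). *)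

theory Defs
  imports Main
begin

definition right_act :: "'a set \<Rightarrow> ('a \<Rightarrow> 's::semigroup_mult \<Rightarrow> 'a) \<Rightarrow> bool" where
  "right_act A act \<longleftrightarrow> A \<noteq> {} \<and> (\<forall>a\<in>A. \<forall>s. act a s \<in> A) \<and>
     (\<forall>a\<in>A. \<forall>s t. act a (s * t) = act (act a s) t)"

definition subact :: "'a set \<Rightarrow> 'a set \<Rightarrow> ('a \<Rightarrow> 's::semigroup_mult \<Rightarrow> 'a) \<Rightarrow> bool" where
  "subact B A act \<longleftrightarrow> B \<noteq> {} \<and> B \<subseteq> A \<and> (\<forall>b\<in>B. \<forall>s. act b s \<in> B)"

definition nonzero_subact :: "'a set \<Rightarrow> 'a set \<Rightarrow> ('a \<Rightarrow> 's::semigroup_mult \<Rightarrow> 'a) \<Rightarrow> bool" where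
  "nonzero_subact B A act \<longleftrightarrow> subact B A act \<and> \<not> is_singleton B"

definition act_hom ::
    "('a \<Rightarrow> 'c) \<Rightarrow> 'a set \<Rightarrow> ('a \<Rightarrow> 's::semigroup_mult \<Rightarrow> 'a) \<Rightarrow> 'c set \<Rightarrow> ('c \<Rightarrow> 's \<Rightarrow> 'c) \<Rightarrow> bool" where
  "act_hom f A actA C actC \<longleftrightarrow>
     (\<forall>a\<in>A. f a \<in> C) \<and> (\<forall>a\<in>A. \<forall>s. f (actA a s) = actC (f a) s)"

text \<open>
  A definition cannot quantify over types, so the codomain \<open>C\<close> ranges over the acts carried by
  subsets of the element type of \<open>A\<close>. Nothing is lost: every homomorphic image of \<open>A\<close> is isomorphic
  to such an act, and \<open>large_inj\<close> below gives the property for codomains over an arbitrary type.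
\<close>

definition large :: "'a set \<Rightarrow> 'a set \<Rightarrow> ('a \<Rightarrow> 's::semigroup_mult \<Rightarrow> 'a) \<Rightarrow> bool" where
  "large B A act \<longleftrightarrow> subact B A act \<and>
     (\<forall>(C :: 'a set) actC g.
        right_act C actC \<and> act_hom g A act C actC \<and> inj_on g B \<longrightarrow> inj_on g A)"

lemma large_inj:
  fixes A B :: "'a set" and act :: "'a \<Rightarrow> 's::semigroup_mult \<Rightarrow> 'a"
    and C :: "'c set" and actC :: "'c \<Rightarrow> 's \<Rightarrow> 'c" and g :: "'a \<Rightarrow> 'c"
  assumes A: "right_act A act" and L: "large B A act"
    and hom: "act_hom g A act C actC" and inj: "inj_on g B"
  shows "inj_on g A"
proof -
  define h where "h = inv_into A g"
  define k where "k = h \<circ> g"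
  define actK where "actK = (\<lambda>x s. k (act x s))"
  have clo: "act a s \<in> A" if "a \<in> A" for a s
    using A that by (auto simp: right_act_def)
  have assoc: "act a (s * t) = act (act a s) t" if "a \<in> A" for a s t
    using A that by (auto simp: right_act_def)
  have gact: "g (act a s) = actC (g a) s" if "a \<in> A" for a s
    using hom that by (auto simp: act_hom_def)
  have kA: "k a \<in> A" if "a \<in> A" for a
    using that by (simp add: k_def h_def inv_into_into)
  have gk: "g (k a) = g a" if "a \<in> A" for a
    using that by (simp add: k_def h_def f_inv_into_f)
  have kact: "k (act (k a) s) = k (act a s)" if "a \<in> A" for a s
    using gact[OF that, of s] gact[OF kA[OF that], of s] gk[OF that] by (simp add: k_def)
  have K: "right_act (k ` A) actK"
    unfolding right_act_def actK_def
  proof (intro conjI ballI allI)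
    show "k ` A \<noteq> {}"
      using A by (simp add: right_act_def)
    show "k (act x s) \<in> k ` A" if "x \<in> k ` A" for x s
      using that clo kA by blast
    show "k (act x (s * t)) = k (act (k (act x s)) t)" if "x \<in> k ` A" for x s t
    proof -
      have x: "x \<in> A"
        using that kA by blast
      show ?thesis
        using kact[OF clo[OF x]] assoc[OF x] by simp
    qed
  qed
  have H: "act_hom k A act (k ` A) actK"
    unfolding act_hom_def actK_def by (simp add: kact)
  have "B \<subseteq> A"
    using L by (simp add: large_def subact_def)
  have "inj_on k B"
  proof (rule inj_onI)
    fix x y assume xy: "x \<in> B" "y \<in> B" "k x = k y"
    then have "x \<in> A" "y \<in> A"
      using \<open>B \<subseteq> A\<close> by blast+
    then have "g x = g y"
      using gk[of x] gk[of y] xy(3) by simp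
    then show "x = y"
      using inj xy by (simp add: inj_on_def)
  qed
  with L K H have "inj_on k A"
    unfolding large_def by blast
  then show ?thesis
    by (auto simp: inj_on_def k_def)
qed

definition uniform_act :: "'a set \<Rightarrow> ('a \<Rightarrow> 's::semigroup_mult \<Rightarrow> 'a) \<Rightarrow> bool" where
  "uniform_act A act \<longleftrightarrow>
     right_act A act \<and> (\<forall>B. nonzero_subact B A act \<longrightarrow> large B A act)"

definition uniform_semigroup :: "'s::semigroup_mult itself \<Rightarrow> bool" where
  "uniform_semigroup _ \<longleftrightarrow> uniform_act (UNIV :: 's set) (\<lambda>a s. a * s)"

definition idempotents :: "'s::semigroup_mult set" where
  "idempotents = {e. e * e = e}"

definition E_semigroup :: "'s::semigroup_mult itself \<Rightarrow> bool" where
  "E_semigroup _ \<longleftrightarrow>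
     (\<forall>e \<in> (idempotents :: 's set). \<forall>f \<in> idempotents. e * f \<in> idempotents)"

end

theory Submission
  imports Defs
begin

text \<open>
  For an idempotent \<open>e\<close>, left multiplication by \<open>e\<close> is an endomorphism of \<open>S\<close> that is the identity
  on the right ideal \<open>eS\<close>. If \<open>eS\<close> has more than one element it is large, so left multiplication by
  \<open>e\<close> is injective, and \<open>e (e x) = e x\<close> yields \<open>e x = x\<close>. Hence every idempotent is a left zero or
  a left identity, and the product of two of them is one of the factors.
\<close>

lemma uniform_semigroup_idempotent_cases:
  fixes e :: "'s::semigroup_mult"
  assumes unif: "uniform_semigroup TYPE('s)" and e: "e * e = e"
  shows "(\<forall>x. e * x = e) \<or> (\<forall>x. e * x = x)"
proof (cases "is_singleton (range ((*) e))")
  case True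
  \<comment> \<open>Both \<open>e * x\<close> and \<open>e * e\<close> lie in the one-element range;
    as \<open>e * e = e\<close>, this makes \<open>e\<close> a left zero.\<close>
  then have "e * x = e * e" for x
    by (metis is_singletonE rangeI singletonD)
  with e show ?thesis
    by simp
next
  case False
  have idem: "e * (e * x) = e * x" for x
    using e by (metis mult.assoc)
  have "subact (range ((*) e)) UNIV (*)"
    by (auto simp: subact_def mult.assoc)
  with False unif have L: "large (range ((*) e)) UNIV (*)" and A: "right_act (UNIV :: 's set) (*)"
    by (auto simp: nonzero_subact_def uniform_semigroup_def uniform_act_def)
  have "act_hom ((*) e) UNIV (*) UNIV (*)"
    by (simp add: act_hom_def mult.assoc)
  \<comment> \<open>By \<open>idem\<close>, left multiplication by \<open>e\<close> fixes every
    element of its range.\<close>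
  moreover have "inj_on ((*) e) (range ((*) e))"
    by (auto simp: inj_on_def idem)
  ultimately have "inj ((*) e)"
    using large_inj[OF A L] by blast
  with idem show ?thesis
    by (auto dest: injD)
qed

theorem corollary2p10:
  assumes "\<exists>x y :: 's::semigroup_mult. x \<noteq> y"
    and "uniform_semigroup TYPE('s)"
  shows "E_semigroup TYPE('s)"
  unfolding E_semigroup_def
proof (intro ballI)
  fix e f :: 's
  assume "e \<in> idempotents" "f \<in> idempotents"
  \<comment> \<open>The dichotomy for \<open>e\<close> alone suffices: \<open>e * f\<close> is
    \<open>e\<close> if \<open>e\<close> is a left zero and \<open>f\<close> if \<open>e\<close> is
    a left identity.\<close>
  with uniform_semigroup_idempotent_cases[OF assms(2), of e] show "e * f \<in> idempotents"
    by (auto simp: idempotents_def)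
qed

end
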